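(* Let $I=[0,1]$, let the maps $L_i:I\to I_i$ be similarities, and let $f_1:I\to\mathbb R$ be the hidden variable fractal interpolation function (HVFIF) constructed in the context. Suppose $$\max\{\omega,\tilde\omega\}<\frac{|I_{\min}|}{2|I_{\max}|}.$$ Then there exist a positive constant $L_1$ and $\tau_1$ with $0<\tau_1\le 1$ such that for all $x,\bar x\in I$ $$|f_1(x)-f_1(\bar x)|\le L_1|x-\bar x|^{\tau_1}.$$
   Context: Let $P=\{(x_i,y_i,z_i)=(x_i,\vec y_i)\in\mathbb R^3 : i=0,1,\dots,n\}$ with $0=x_0<x_1<\dots<x_n=1$ and $\vec y_i=(y_i,z_i)$ (the $z_i$ are real parameters extending the given data set $P_0=\{(x_i,y_i)\}$). Put $I=[x_0,x_n]=[0,1]$ and $I_i=[x_{i-1},x_i]$ for $i=1,\dots,n$; $|I_i|$ is the length of $I_i$, $|I_{\min}|=\min_i|I_i|$, $|I_{\max}|=\max_i|I_i|$. For each $i=1,\dots,n$: $L_i:I\to I_i$ is a contraction homeomorphism (here a similarity) with $L_i(\{x_0,x_n\})=\{x_{i-1},x_i\}$; $s_i,s'_i,\tilde s_i,\tilde s'_i:I_i\to\mathbb R$ are Lipschitz functions whose absolute values are less than $1$; $g_i,g'_i:I\to\mathbb R$ and $h_i,\tilde h_i:I_i\to\mathbb R$ are Lipschitz functions with $g_i(x_\alpha)=y_\alpha$, $g'_i(x_\alpha)=z_\alpha$ for $\alpha\in\{0,n\}$ and $h_i(x_a)=y_a$, $\tilde h_i(x_a)=z_a$ for $a\in\{i-1,i\}$.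 For $x\in I$ define $$q_i(x)=-s_i(L_i(x))g_i(x)-s'_i(L_i(x))g'_i(x)+h_i(L_i(x)),$$ $$\tilde q_i(x)=-\tilde s_i(L_i(x))g_i(x)-\tilde s'_i(L_i(x))g'_i(x)+\tilde h_i(L_i(x)).$$ It is assumed that $S=\max\{\|s_i\|_\infty+\|\tilde s_i\|_\infty,\ \|s'_i\|_\infty+\|\tilde s'_i\|_\infty : i=1,\dots,n\}<1$, where $\|\cdot\|_\infty$ is the sup norm. Then there is a unique continuous $\vec f=(f_1,f_2):I\to\mathbb R^2$ with $\vec f(x_i)=\vec y_i$ ($i=0,\dots,n$) satisfying, for all $i$ and all $x\in I_i$, $$f_1(x)=s_i(x)f_1(L_i^{-1}(x))+s'_i(x)f_2(L_i^{-1}(x))+q_i(L_i^{-1}(x)),$$ $$f_2(x)=\tilde s_i(x)f_1(L_i^{-1}(x))+\tilde s'_i(x)f_2(L_i^{-1}(x))+\tilde q_i(L_i^{-1}(x)).$$ The first component $f_1$, which interpolates $P_0$, is called the hidden variable fractal interpolation function (HVFIF). Notation: $\overline\omega_k=\max_{x\in I_k}\{|s_k(x)|,|s'_k(x)|\}$, $\overline{\tilde\omega}_k=\max_{x\in I_k}\{|\tilde s_k(x)|,|\tilde s'_k(x)|\}$, $\omega=\max_k\overline\omega_k$, $\tilde\omega=\max_k\overline{\tilde\omega}_k$. *)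

theory Defs
  imports "HOL-Analysis.Analysis"
begin

definition subint :: "(nat \<Rightarrow> real) \<Rightarrow> nat \<Rightarrow> real set" where
  "subint x i = {x (i - 1)..x i}"

definition len_min :: "nat \<Rightarrow> (nat \<Rightarrow> real) \<Rightarrow> real" where
  "len_min n x = Min ((\<lambda>i. x i - x (i - 1)) ` {1..n})"

definition len_max :: "nat \<Rightarrow> (nat \<Rightarrow> real) \<Rightarrow> real" where
  "len_max n x = Max ((\<lambda>i. x i - x (i - 1)) ` {1..n})"

definition supnorm :: "real set \<Rightarrow> (real \<Rightarrow> real) \<Rightarrow> real" where
  "supnorm A u = (SUP t\<in>A. \<bar>u t\<bar>)"

definition lipschitz_fun :: "real set \<Rightarrow> (real \<Rightarrow> real) \<Rightarrow> bool" where
  "lipschitz_fun A u \<longleftrightarrow> (\<exists>C. C-lipschitz_on A u)"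

definition similarity_contraction :: "real set \<Rightarrow> real set \<Rightarrow> (real \<Rightarrow> real) \<Rightarrow> bool" where
  "similarity_contraction A B u \<longleftrightarrow>
     (\<exists>v. homeomorphism A B u v) \<and>
     (\<exists>c. 0 < c \<and> c < 1 \<and> (\<forall>a\<in>A. \<forall>b\<in>A. dist (u a) (u b) = c * dist a b))"

text \<open>The inner maximum over the compact interval is written as a supremum; it is attained,
  because the functions it is applied to are continuous.\<close>

definition omega :: "nat \<Rightarrow> (nat \<Rightarrow> real) \<Rightarrow> (nat \<Rightarrow> real \<Rightarrow> real) \<Rightarrow> (nat \<Rightarrow> real \<Rightarrow> real) \<Rightarrow> real" where
  "omega n x s s' = Max ((\<lambda>k. SUP t\<in>subint x k. max \<bar>s k t\<bar> \<bar>s' k t\<bar>) ` {1..n})"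

text \<open>Here and below, \<open>st\<close>, \<open>st'\<close>, \<open>ht\<close>, \<open>qt\<close> are the functions written with a tilde. Every
  function that the construction gives on a subinterval only is a total function of which
  only the values on that subinterval are used.\<close>

definition S_const ::
  "nat \<Rightarrow> (nat \<Rightarrow> real) \<Rightarrow> (nat \<Rightarrow> real \<Rightarrow> real) \<Rightarrow> (nat \<Rightarrow> real \<Rightarrow> real) \<Rightarrow>
   (nat \<Rightarrow> real \<Rightarrow> real) \<Rightarrow> (nat \<Rightarrow> real \<Rightarrow> real) \<Rightarrow> real" where
  "S_const n x s s' st st' =
     Max ((\<lambda>i. max (supnorm (subint x i) (s i) + supnorm (subint x i) (st i))
                   (supnorm (subint x i) (s' i) + supnorm (subint x i) (st' i))) ` {1..n})"

definition qfun ::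
  "(nat \<Rightarrow> real \<Rightarrow> real) \<Rightarrow> (nat \<Rightarrow> real \<Rightarrow> real) \<Rightarrow> (nat \<Rightarrow> real \<Rightarrow> real) \<Rightarrow>
   (nat \<Rightarrow> real \<Rightarrow> real) \<Rightarrow> (nat \<Rightarrow> real \<Rightarrow> real) \<Rightarrow> (nat \<Rightarrow> real \<Rightarrow> real) \<Rightarrow>
   nat \<Rightarrow> real \<Rightarrow> real" where
  "qfun L s s' g g' h i t = - s i (L i t) * g i t - s' i (L i t) * g' i t + h i (L i t)"

locale hvfif_setup =
  fixes n :: nat
    and x y z :: "nat \<Rightarrow> real"
    and L s s' st st' g g' h ht :: "nat \<Rightarrow> real \<Rightarrow> real"
  assumes x_0: "x 0 = 0"
    and x_n: "x n = 1"
    and x_less: "\<And>i. i < n \<Longrightarrow> x i < x (Suc i)"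
    and L_sim: "\<And>i. i \<in> {1..n} \<Longrightarrow> similarity_contraction {x 0..x n} (subint x i) (L i)"
    and L_ends: "\<And>i. i \<in> {1..n} \<Longrightarrow> L i ` {x 0, x n} = {x (i - 1), x i}"
    and s_lip: "\<And>i. i \<in> {1..n} \<Longrightarrow> lipschitz_fun (subint x i) (s i)"
    and s'_lip: "\<And>i. i \<in> {1..n} \<Longrightarrow> lipschitz_fun (subint x i) (s' i)"
    and st_lip: "\<And>i. i \<in> {1..n} \<Longrightarrow> lipschitz_fun (subint x i) (st i)"
    and st'_lip: "\<And>i. i \<in> {1..n} \<Longrightarrow> lipschitz_fun (subint x i) (st' i)"
    and s_less: "\<And>i t. i \<in> {1..n} \<Longrightarrow> t \<in> subint x i \<Longrightarrow> \<bar>s i t\<bar> < 1"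
    and s'_less: "\<And>i t. i \<in> {1..n} \<Longrightarrow> t \<in> subint x i \<Longrightarrow> \<bar>s' i t\<bar> < 1"
    and st_less: "\<And>i t. i \<in> {1..n} \<Longrightarrow> t \<in> subint x i \<Longrightarrow> \<bar>st i t\<bar> < 1"
    and st'_less: "\<And>i t. i \<in> {1..n} \<Longrightarrow> t \<in> subint x i \<Longrightarrow> \<bar>st' i t\<bar> < 1"
    and g_lip: "\<And>i. i \<in> {1..n} \<Longrightarrow> lipschitz_fun {x 0..x n} (g i)"
    and g'_lip: "\<And>i. i \<in> {1..n} \<Longrightarrow> lipschitz_fun {x 0..x n} (g' i)"
    and h_lip: "\<And>i. i \<in> {1..n} \<Longrightarrow> lipschitz_fun (subint x i) (h i)"
    and ht_lip: "\<And>i. i \<in> {1..n} \<Longrightarrow> lipschitz_fun (subint x i) (ht i)"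
    and g_ends: "\<And>i a. i \<in> {1..n} \<Longrightarrow> a \<in> {0, n} \<Longrightarrow> g i (x a) = y a"
    and g'_ends: "\<And>i a. i \<in> {1..n} \<Longrightarrow> a \<in> {0, n} \<Longrightarrow> g' i (x a) = z a"
    and h_ends: "\<And>i a. i \<in> {1..n} \<Longrightarrow> a \<in> {i - 1, i} \<Longrightarrow> h i (x a) = y a"
    and ht_ends: "\<And>i a. i \<in> {1..n} \<Longrightarrow> a \<in> {i - 1, i} \<Longrightarrow> ht i (x a) = z a"
    and S_less: "S_const n x s s' st st' < 1"

text \<open>The pair \<open>(f1, f2)\<close> is the vector-valued interpolation function; under
  \<open>hvfif_setup\<close> it is uniquely
  determined on \<open>[x 0, x n]\<close> by these conditions.\<close>

definition hvfif_pair ::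
  "nat \<Rightarrow> (nat \<Rightarrow> real) \<Rightarrow> (nat \<Rightarrow> real) \<Rightarrow> (nat \<Rightarrow> real) \<Rightarrow> (nat \<Rightarrow> real \<Rightarrow> real) \<Rightarrow>
   (nat \<Rightarrow> real \<Rightarrow> real) \<Rightarrow> (nat \<Rightarrow> real \<Rightarrow> real) \<Rightarrow> (nat \<Rightarrow> real \<Rightarrow> real) \<Rightarrow> (nat \<Rightarrow> real \<Rightarrow> real) \<Rightarrow>
   (nat \<Rightarrow> real \<Rightarrow> real) \<Rightarrow> (nat \<Rightarrow> real \<Rightarrow> real) \<Rightarrow> (nat \<Rightarrow> real \<Rightarrow> real) \<Rightarrow> (nat \<Rightarrow> real \<Rightarrow> real) \<Rightarrow>
   (real \<Rightarrow> real) \<Rightarrow> (real \<Rightarrow> real) \<Rightarrow> bool" where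
  "hvfif_pair n x y z L s s' st st' g g' h ht f1 f2 \<longleftrightarrow>
     continuous_on {x 0..x n} (\<lambda>t. (f1 t, f2 t)) \<and>
     (\<forall>i\<in>{0..n}. f1 (x i) = y i \<and> f2 (x i) = z i) \<and>
     (\<forall>i\<in>{1..n}. \<forall>t\<in>subint x i.
        let u = the_inv_into {x 0..x n} (L i) t;
            q = qfun L s s' g g' h;
            qt = qfun L st st' g g' ht
        in f1 t = s i t * f1 u + s' i t * f2 u + q i u \<and>
           f2 t = st i t * f1 u + st' i t * f2 u + qt i u)"

definition is_HVFIF ::
  "nat \<Rightarrow> (nat \<Rightarrow> real) \<Rightarrow> (nat \<Rightarrow> real) \<Rightarrow> (nat \<Rightarrow> real) \<Rightarrow> (nat \<Rightarrow> real \<Rightarrow> real) \<Rightarrow>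
   (nat \<Rightarrow> real \<Rightarrow> real) \<Rightarrow> (nat \<Rightarrow> real \<Rightarrow> real) \<Rightarrow> (nat \<Rightarrow> real \<Rightarrow> real) \<Rightarrow> (nat \<Rightarrow> real \<Rightarrow> real) \<Rightarrow>
   (nat \<Rightarrow> real \<Rightarrow> real) \<Rightarrow> (nat \<Rightarrow> real \<Rightarrow> real) \<Rightarrow> (nat \<Rightarrow> real \<Rightarrow> real) \<Rightarrow> (nat \<Rightarrow> real \<Rightarrow> real) \<Rightarrow>
   (real \<Rightarrow> real) \<Rightarrow> bool" where
  "is_HVFIF n x y z L s s' st st' g g' h ht f1 \<longleftrightarrow>
     (\<exists>f2. hvfif_pair n x y z L s s' st st' g g' h ht f1 f2)"

end

theory Submission
  imports Defs
begin

text \<open>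
  Measure the oscillation of the vector-valued function by
  \<open>D a b = max \<bar>f1 a - f1 b\<bar> \<bar>f2 a - f2 b\<bar>\<close>. Substituting \<open>t = L i u\<close> in the two functional
  equations writes both components at \<open>L i u\<close> as combinations of \<open>f1 u\<close> and \<open>f2 u\<close> whose
  coefficients are Lipschitz in \<open>u\<close> and bounded by \<open>w\<close>, the maximum of the two constants
  \<open>omega\<close>, plus a Lipschitz term. Hence
  \<open>D (L i u) (L i v) \<le> K * \<bar>u - v\<bar> + q * D u v\<close> with \<open>q = 2 * w\<close> (lemma \<open>increment_bound\<close>).
  The smallness hypothesis gives \<open>q < 1\<close>, because the shortest subinterval is at most as long as
  the longest one.

  Since \<open>m powr \<tau>\<close> tends to \<open>1\<close> as \<open>\<tau>\<close> tends to \<open>0\<close>, where \<open>m\<close> is the length of the shortest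
  subinterval, some exponent \<open>\<tau> \<le> 1\<close> satisfies \<open>q < m powr \<tau>\<close>. Passing from \<open>(u, v)\<close> to
  \<open>(L i u, L i v)\<close> multiplies \<open>\<bar>u - v\<bar> powr \<tau>\<close> by at least \<open>m powr \<tau>\<close> but the oscillation by at
  most \<open>q\<close>, up to a Lipschitz error. So a bound \<open>D \<le> A * \<bar>u - v\<bar> powr \<tau>\<close> with \<open>A\<close> large is
  inherited by the image pair (lemma \<open>step_holder\<close>), and an additive error in that bound shrinks
  by the factor \<open>q\<close>. Pulling back \<open>k\<close> times and letting \<open>k\<close> tend to infinity removes the error
  (lemma \<open>holder_by_descent\<close>).

  What remains is pairs in different subintervals, which cannot be pulled back together. If a
  whole subinterval separates the points, their distance is at least \<open>m\<close> and boundedness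
  suffices. If they lie in adjacent subintervals, one splits at the common knot. Splitting
  doubles the constant, which would be fatal if it recurred at every level. It does not:
  pairs with an endpoint of \<open>[0, 1]\<close> are treated first, and they never need to be split because
  endpoints pull back to endpoints. Their images give the estimate at knots, with the same
  constant \<open>A\<close>; the descent for arbitrary pairs then runs with \<open>2 * A\<close>, and every split
  ends it at once.
\<close>

section \<open>Increments that contract under a piecewise similarity\<close>

text \<open>Only the increment \<open>D\<close> of the function is kept, so that the argument treats both
  components at once; \<open>m\<close> is a lower bound for the lengths of the subintervals and hence for the
  ratios of the similarities.\<close>

locale selfsimilar_increments =
  fixes n :: nat and x :: "nat \<Rightarrow> real" and L :: "nat \<Rightarrow> real \<Rightarrow> real"
    and D :: "real \<Rightarrow> real \<Rightarrow> real" and m K q M :: real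
  assumes x_0: "x 0 = 0"
    and x_n: "x n = 1"
    and m_pos: "0 < m"
    and m_le: "\<And>i. i \<in> {1..n} \<Longrightarrow> m \<le> x i - x (i - 1)"
    and L_onto: "\<And>i. i \<in> {1..n} \<Longrightarrow> L i ` {0..1} = {x (i - 1)..x i}"
    and L_ends: "\<And>i. i \<in> {1..n} \<Longrightarrow> L i ` {0, 1} = {x (i - 1), x i}"
    and L_scale: "\<And>i u v. i \<in> {1..n} \<Longrightarrow> u \<in> {0..1} \<Longrightarrow> v \<in> {0..1} \<Longrightarrow>
                    \<bar>L i u - L i v\<bar> = (x i - x (i - 1)) * \<bar>u - v\<bar>"
    and D_sym: "\<And>a b. D a b = D b a"
    and D_triangle: "\<And>a b c. D a c \<le> D a b + D b c"
    and D_bound: "\<And>a b. a \<in> {0..1} \<Longrightarrow> b \<in> {0..1} \<Longrightarrow> D a b \<le> M"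
    and D_step: "\<And>i u v. i \<in> {1..n} \<Longrightarrow> u \<in> {0..1} \<Longrightarrow> v \<in> {0..1} \<Longrightarrow>
                   D (L i u) (L i v) \<le> K * \<bar>u - v\<bar> + q * D u v"
    and K_nonneg: "0 \<le> K" and M_nonneg: "0 \<le> M" and q_nonneg: "0 \<le> q" and q_less: "q < 1"
begin

lemma n_pos: "0 < n"
  using x_0 x_n by (cases n) auto

lemma knots_mono: "i \<le> j \<Longrightarrow> j \<le> n \<Longrightarrow> x i \<le> x j"
proof (induction j)
  case (Suc j)
  have "x j \<le> x (Suc j)"
    using m_le[of "Suc j"] m_pos Suc.prems by simp
  then show ?case
    using Suc by (cases "i = Suc j") auto
qed simp

lemma exists_piece:
  assumes "t \<in> {0..1}"
  obtains i where "i \<in> {1..n}" "t \<in> {x (i - 1)..x i}"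
proof -
  define i where "i = (LEAST i. 1 \<le> i \<and> t \<le> x i)"
  have wit: "1 \<le> n \<and> t \<le> x n"
    using n_pos x_n assms by simp
  have i: "1 \<le> i \<and> t \<le> x i"
    unfolding i_def by (rule LeastI[of _ n]) (rule wit)
  have "i \<le> n"
    unfolding i_def by (rule Least_le) (rule wit)
  moreover have "x (i - 1) \<le> t"
  proof (cases "i = 1")
    case True
    then show ?thesis using x_0 assms by simp
  next
    case False
    then have "\<not> (1 \<le> i - 1 \<and> t \<le> x (i - 1))"
      using i not_less_Least[of "i - 1" "\<lambda>i. 1 \<le> i \<and> t \<le> x i"] unfolding i_def[symmetric] by simp
    then show ?thesis using False i by auto
  qed
  ultimately show ?thesis using i that[of i] by simp
qed

text \<open>The condition on \<open>A\<close> says that the Lipschitz error \<open>K\<close> fits into the gain from \<open>q\<close> to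
  \<open>m powr \<tau>\<close>; for distances in the unit interval a Lipschitz error is also a Hoelder error, as
  \<open>\<tau> \<le> 1\<close>.\<close>

lemma step_holder:
  assumes i: "i \<in> {1..n}" and uv: "u \<in> {0..1}" "v \<in> {0..1}"
    and \<tau>: "0 < \<tau>" "\<tau> \<le> 1" and A: "0 \<le> A" "K + q * A \<le> A * m powr \<tau>"
    and D: "D u v \<le> A * \<bar>u - v\<bar> powr \<tau> + e"
  shows "D (L i u) (L i v) \<le> A * \<bar>L i u - L i v\<bar> powr \<tau> + q * e"
proof -
  define w where "w = \<bar>u - v\<bar>"
  have w: "0 \<le> w" "w \<le> 1"
    using uv by (auto simp: w_def)
  have w_le: "w \<le> w powr \<tau>"
    using powr_mono'[of \<tau> 1 w] w \<tau> by simp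
  have "D (L i u) (L i v) \<le> K * w + q * (A * w powr \<tau> + e)"
    using D_step[OF i uv] mult_left_mono[OF D q_nonneg] by (simp add: w_def)
  also have "\<dots> \<le> K * w powr \<tau> + q * (A * w powr \<tau> + e)"
    using mult_left_mono[OF w_le K_nonneg] by simp
  also have "\<dots> = (K + q * A) * w powr \<tau> + q * e"
    by (simp add: algebra_simps)
  also have "\<dots> \<le> A * m powr \<tau> * w powr \<tau> + q * e"
    using mult_right_mono[OF A(2), of "w powr \<tau>"] by simp
  also have "\<dots> = A * (m * w) powr \<tau> + q * e"
    using m_pos w by (simp add: powr_mult)
  also have "\<dots> \<le> A * \<bar>L i u - L i v\<bar> powr \<tau> + q * e"
  proof -
    have "m * w \<le> \<bar>L i u - L i v\<bar>"
      using L_scale[OF i uv] mult_right_mono[OF m_le[OF i] w(1)] by (simp add: w_def)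
    then have "(m * w) powr \<tau> \<le> \<bar>L i u - L i v\<bar> powr \<tau>"
      using m_pos w \<tau> by (intro powr_mono2) auto
    then show ?thesis using A(1) by (simp add: mult_left_mono)
  qed
  finally show ?thesis .
qed

text \<open>The trivial bound \<open>D \<le> M\<close> is an instance of the estimate with additive error \<open>M\<close>. Each
  pull-back inside \<open>R\<close> improves the error by the factor \<open>q\<close>, so in the limit none is left. The
  relation \<open>R\<close> makes the same argument serve for pairs with an endpoint and for all pairs.\<close>

lemma holder_by_descent:
  assumes \<tau>: "0 < \<tau>" "\<tau> \<le> 1" and A: "0 \<le> A" "K + q * A \<le> A * m powr \<tau>"
    and R: "R a b"
    and R_unit: "\<And>a b. R a b \<Longrightarrow> a \<in> {0..1} \<and> b \<in> {0..1}"
    and descent: "\<And>a b. R a b \<Longrightarrow> D a b \<le> A * \<bar>a - b\<bar> powr \<tau> \<or>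
        (\<exists>i\<in>{1..n}. \<exists>u v. R u v \<and> a = L i u \<and> b = L i v)"
  shows "D a b \<le> A * \<bar>a - b\<bar> powr \<tau>"
proof -
  have approx: "R a b \<Longrightarrow> D a b \<le> A * \<bar>a - b\<bar> powr \<tau> + q ^ k * M" for a b k
  proof (induction k arbitrary: a b)
    case 0
    have "0 \<le> A * \<bar>a - b\<bar> powr \<tau>" using A(1) by simp
    then show ?case using D_bound R_unit[OF 0] by (simp add: add_increasing)
  next
    case (Suc k)
    from descent[OF Suc.prems] show ?case
    proof
      assume "D a b \<le> A * \<bar>a - b\<bar> powr \<tau>"
      moreover have "0 \<le> q ^ Suc k * M" using q_nonneg M_nonneg by simp
      ultimately show ?thesis by linarith
    next
      assume "\<exists>i\<in>{1..n}. \<exists>u v. R u v \<and> a = L i u \<and> b = L i v"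
      then obtain i u v where i: "i \<in> {1..n}" "R u v" "a = L i u" "b = L i v" by blast
      then show ?thesis
        using step_holder[OF i(1) _ _ \<tau> A Suc.IH[OF i(2)]] R_unit[OF i(2)] by (simp add: mult.assoc)
    qed
  qed
  have "(\<lambda>k. A * \<bar>a - b\<bar> powr \<tau> + q ^ k * M) \<longlonglongrightarrow> A * \<bar>a - b\<bar> powr \<tau> + 0 * M"
    using q_nonneg q_less by (intro tendsto_intros LIMSEQ_realpow_zero)
  then show ?thesis
    using approx[OF R] by (intro LIMSEQ_le_const) auto
qed

text \<open>The descent is run twice, for pairs with an endpoint of \<open>[0, 1]\<close> and then for all pairs;
  the first run bounds what is left after splitting at a knot in the second.\<close>

theorem holder:
  "\<exists>B \<tau>. 0 < B \<and> 0 < \<tau> \<and> \<tau> \<le> 1 \<and>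
     (\<forall>a\<in>{0..1}. \<forall>b\<in>{0..1}. D a b \<le> B * \<bar>a - b\<bar> powr \<tau>)"
proof -
  obtain \<tau> where \<tau>: "0 < \<tau>" "\<tau> \<le> 1" and q_m: "q < m powr \<tau>"
  proof -
    have "((\<lambda>\<tau>. m powr \<tau>) \<longlongrightarrow> m powr 0) (at_right 0)"
      using m_pos by (intro tendsto_intros) auto
    then have "\<forall>\<^sub>F \<tau> in at_right 0. q < m powr \<tau>"
      using m_pos q_less by (intro order_tendstoD) auto
    moreover have "\<forall>\<^sub>F \<tau> in at_right (0::real). \<tau> \<in> {0<..<1}"
      by (rule eventually_at_right_real) simp
    ultimately have "\<forall>\<^sub>F \<tau> in at_right (0::real). q < m powr \<tau> \<and> \<tau> \<in> {0<..<1}"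
      by (rule eventually_conj)
    then obtain \<tau> where "q < m powr \<tau> \<and> \<tau> \<in> {0<..<1}"
      using eventually_happens'[OF trivial_limit_at_right_real] by blast
    then show ?thesis using that by auto
  qed
  \<comment> \<open>The first summand makes the step estimate work, the second covers pairs at distance at
    least \<open>m\<close>, and the last makes \<open>A\<close> positive when \<open>K\<close> and \<open>M\<close> vanish.\<close>
  define A where "A = K / (m powr \<tau> - q) + M / m powr \<tau> + 1"
  have m\<tau>: "0 < m powr \<tau>" using m_pos by simp
  have A_pos: "0 < A"
    unfolding A_def using K_nonneg M_nonneg q_m m\<tau> by (intro add_nonneg_pos add_nonneg_nonneg) auto
  have "K = K / (m powr \<tau> - q) * (m powr \<tau> - q)"
    using q_m by simp
  also have "\<dots> \<le> A * (m powr \<tau> - q)"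
    using q_m M_nonneg m\<tau> by (intro mult_right_mono) (auto simp: A_def)
  finally have A_step: "K + q * A \<le> A * m powr \<tau>"
    by (simp add: algebra_simps)
  have "M = M / m powr \<tau> * m powr \<tau>"
    using m\<tau> by simp
  also have "\<dots> \<le> A * m powr \<tau>"
    using q_m K_nonneg m\<tau> by (intro mult_right_mono) (auto simp: A_def)
  finally have A_M: "M \<le> A * m powr \<tau>" .
  have far: "D a b \<le> A * \<bar>a - b\<bar> powr \<tau>"
    if "a \<in> {0..1}" "b \<in> {0..1}" "m \<le> \<bar>a - b\<bar>" for a b
  proof -
    have "m powr \<tau> \<le> \<bar>a - b\<bar> powr \<tau>"
      using that m_pos \<tau> by (intro powr_mono2) auto
    then have "A * m powr \<tau> \<le> A * \<bar>a - b\<bar> powr \<tau>"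
      using A_pos by simp
    then show ?thesis using D_bound[OF that(1,2)] A_M by linarith
  qed
  have pull: "\<exists>u\<in>{0..1}. \<exists>e\<in>{0, 1}. t = L i u \<and> k = L i e"
    if "i \<in> {1..n}" "t \<in> {x (i - 1)..x i}" "k \<in> {x (i - 1), x i}" for i t k
  proof -
    have "t \<in> L i ` {0..1}" using L_onto[OF that(1)] that(2) by simp
    moreover have "k \<in> L i ` {0, 1}" using L_ends[OF that(1)] that(3) by simp
    ultimately show ?thesis by blast
  qed
  have endpoint: "D t e \<le> A * \<bar>t - e\<bar> powr \<tau>" if "t \<in> {0..1}" "e \<in> {0, 1}" for t e
  proof (rule holder_by_descent[where R = "\<lambda>t e. t \<in> {0..1} \<and> e \<in> {0, 1}", OF \<tau> _ A_step])
    show "0 \<le> A" using A_pos by simp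
    show "t \<in> {0..1} \<and> e \<in> {0, 1}" using that by simp
  next
    fix a b :: real
    assume ab: "a \<in> {0..1} \<and> b \<in> {0, 1}"
    then show "a \<in> {0..1} \<and> b \<in> {0..1}" by auto
    \<comment> \<open>The subinterval at the endpoint \<open>b\<close>: the first or the last one.\<close>
    define i where "i = (if b = 0 then 1 else n)"
    have i: "i \<in> {1..n}" "b \<in> {x (i - 1), x i}"
      using n_pos ab x_0 x_n by (auto simp: i_def)
    show "D a b \<le> A * \<bar>a - b\<bar> powr \<tau> \<or>
        (\<exists>i\<in>{1..n}. \<exists>u v. (u \<in> {0..1} \<and> v \<in> {0, 1}) \<and> a = L i u \<and> b = L i v)"
    proof (cases "a \<in> {x (i - 1)..x i}")
      case True
      then show ?thesis using pull[OF i(1) _ i(2)] i(1) by blast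
    next
      case False
      have "m \<le> \<bar>a - b\<bar>"
        using False ab m_le[OF i(1)] x_0 x_n by (auto simp: i_def split: if_splits)
      then have "D a b \<le> A * \<bar>a - b\<bar> powr \<tau>" using far[of a b] ab by fastforce
      then show ?thesis ..
    qed
  qed
  \<comment> \<open>Every knot is the image of an endpoint, so one step transports the endpoint estimate.\<close>
  have knot: "D t k \<le> A * \<bar>t - k\<bar> powr \<tau>"
    if i: "i \<in> {1..n}" and t: "t \<in> {x (i - 1)..x i}" and k: "k \<in> {x (i - 1), x i}" for i t k
  proof -
    obtain u e where u: "u \<in> {0..1}" "e \<in> {0, 1}" "t = L i u" "k = L i e"
      using pull[OF i t k] by blast
    then show ?thesis
      using step_holder[OF i u(1) _ \<tau> _ A_step, of e 0] endpoint[OF u(1,2)] A_pos by auto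
  qed
  \<comment> \<open>Descent is possible inside a subinterval; otherwise the estimate holds outright.\<close>
  have ordered: "D a b \<le> 2 * A * \<bar>a - b\<bar> powr \<tau> \<or>
      (\<exists>i\<in>{1..n}. \<exists>u v. (u \<in> {0..1} \<and> v \<in> {0..1}) \<and> a = L i u \<and> b = L i v)"
    if ab: "a \<in> {0..1}" "b \<in> {0..1}" "a \<le> b" for a b
  proof -
    obtain i where i: "i \<in> {1..n}" "a \<in> {x (i - 1)..x i}" using exists_piece[OF ab(1)] .
    obtain j where j: "j \<in> {1..n}" "b \<in> {x (j - 1)..x j}" using exists_piece[OF ab(2)] .
    show ?thesis
    proof (cases "b \<le> x i")
      case True
      then have "a \<in> L i ` {0..1}" "b \<in> L i ` {0..1}"
        using i ab L_onto[OF i(1)] by auto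
      then show ?thesis using i(1) by blast
    next
      case False
      then have "i < j"
        using knots_mono[of j i] i j by (meson atLeastAtMost_iff leI order_trans)
      have "D a b \<le> 2 * A * \<bar>a - b\<bar> powr \<tau>"
      proof (cases "j = Suc i")
        case True
        have "D a (x i) \<le> A * \<bar>a - x i\<bar> powr \<tau>"
          using knot[OF i] by simp
        also have "\<dots> \<le> A * \<bar>a - b\<bar> powr \<tau>"
          using A_pos \<tau> False i by (intro mult_left_mono powr_mono2) auto
        finally have 1: "D a (x i) \<le> A * \<bar>a - b\<bar> powr \<tau>" .
        have "D (x i) b \<le> A * \<bar>b - x i\<bar> powr \<tau>"
          using knot[OF j, of "x i"] True D_sym by simp
        also have "\<dots> \<le> A * \<bar>a - b\<bar> powr \<tau>"
          using A_pos \<tau> False i by (intro mult_left_mono powr_mono2) auto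
        finally show ?thesis using 1 D_triangle[of a b "x i"] by simp
      next
        case False
        then have "x (Suc i) \<le> x (j - 1)" "m \<le> x (Suc i) - x i"
          using \<open>i < j\<close> j(1) knots_mono[of "Suc i" "j - 1"] m_le[of "Suc i"] by auto
        then have "m \<le> \<bar>a - b\<bar>" using i j by auto
        moreover have "0 \<le> A * \<bar>a - b\<bar> powr \<tau>" using A_pos by simp
        ultimately show ?thesis using far[OF ab(1,2)] by linarith
      qed
      then show ?thesis ..
    qed
  qed
  have A2_step: "K + q * (2 * A) \<le> 2 * A * m powr \<tau>"
    using A_step K_nonneg by linarith
  have "D a b \<le> 2 * A * \<bar>a - b\<bar> powr \<tau>" if "a \<in> {0..1}" "b \<in> {0..1}" for a b
  proof (rule holder_by_descent[where R = "\<lambda>a b. a \<in> {0..1} \<and> b \<in> {0..1}", OF \<tau> _ A2_step])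
    show "0 \<le> 2 * A" using A_pos by simp
    show "a \<in> {0..1} \<and> b \<in> {0..1}" using that by simp
  next
    fix a b :: real
    assume ab: "a \<in> {0..1} \<and> b \<in> {0..1}"
    then show "a \<in> {0..1} \<and> b \<in> {0..1}" .
    show "D a b \<le> 2 * A * \<bar>a - b\<bar> powr \<tau> \<or>
        (\<exists>i\<in>{1..n}. \<exists>u v. (u \<in> {0..1} \<and> v \<in> {0..1}) \<and> a = L i u \<and> b = L i v)"
    proof (cases "a \<le> b")
      case True
      then show ?thesis using ordered ab by blast
    next
      case False
      then have "D b a \<le> 2 * A * \<bar>b - a\<bar> powr \<tau> \<or>
        (\<exists>i\<in>{1..n}. \<exists>u v. (u \<in> {0..1} \<and> v \<in> {0..1}) \<and> b = L i u \<and> a = L i v)"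
        using ordered[of b a] ab by simp
      then show ?thesis
        by (simp add: D_sym[of b a] abs_minus_commute[of b a]) blast
    qed
  qed
  then show ?thesis
    using A_pos \<tau> by (intro exI[of _ "2 * A"] exI[of _ \<tau>]) auto
qed

end

section \<open>Lipschitz functions and oscillation of linear combinations\<close>

lemma lipschitz_fun_add:
  "lipschitz_fun X f \<Longrightarrow> lipschitz_fun X g \<Longrightarrow> lipschitz_fun X (\<lambda>t. f t + g t)"
  unfolding lipschitz_fun_def by (blast intro: lipschitz_on_add)

lemma lipschitz_fun_uminus: "lipschitz_fun X f \<Longrightarrow> lipschitz_fun X (\<lambda>t. - f t)"
  unfolding lipschitz_fun_def by (auto intro: lipschitz_on_minus)

lemma lipschitz_fun_compose:
  assumes "lipschitz_fun Y f" "lipschitz_fun X g" "g ` X \<subseteq> Y"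
  shows "lipschitz_fun X (\<lambda>t. f (g t))"
proof -
  obtain C C' where f: "C-lipschitz_on Y f" and g: "C'-lipschitz_on X g"
    using assms(1,2) unfolding lipschitz_fun_def by blast
  from lipschitz_on_compose2[OF g lipschitz_on_subset[OF f assms(3)]] show ?thesis
    unfolding lipschitz_fun_def by (rule exI)
qed

lemma lipschitz_fun_mult:
  assumes f: "lipschitz_fun X f" and g: "lipschitz_fun X g" and X: "bounded X"
  shows "lipschitz_fun X (\<lambda>t. f t * g t)"
proof -
  obtain C C' where C: "C-lipschitz_on X f" and C': "C'-lipschitz_on X g"
    using f g unfolding lipschitz_fun_def by blast
  obtain a where a: "\<And>t. t \<in> X \<Longrightarrow> \<bar>f t\<bar> \<le> a"
    using bounded_uniformly_continuous_image[OF lipschitz_on_uniformly_continuous[OF C] X]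
    unfolding bounded_iff by auto
  obtain b where b: "\<And>t. t \<in> X \<Longrightarrow> \<bar>g t\<bar> \<le> b"
    using bounded_uniformly_continuous_image[OF lipschitz_on_uniformly_continuous[OF C'] X]
    unfolding bounded_iff by auto
  have pos: "0 \<le> C" "0 \<le> C'" using C C' lipschitz_on_nonneg by auto
  have "(\<bar>a\<bar> * C' + C * \<bar>b\<bar>)-lipschitz_on X (\<lambda>t. f t * g t)"
  proof (rule lipschitz_onI)
    fix t t' assume t: "t \<in> X" "t' \<in> X"
    have "\<bar>f t * g t - f t' * g t'\<bar> = \<bar>f t * (g t - g t') + (f t - f t') * g t'\<bar>"
      by (simp add: algebra_simps)
    also have "\<dots> \<le> \<bar>f t\<bar> * \<bar>g t - g t'\<bar> + \<bar>f t - f t'\<bar> * \<bar>g t'\<bar>"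
      by (metis abs_mult abs_triangle_ineq)
    also have "\<dots> \<le> \<bar>a\<bar> * (C' * dist t t') + (C * dist t t') * \<bar>b\<bar>"
      using lipschitz_onD[OF C t] lipschitz_onD[OF C' t] a[OF t(1)] b[OF t(2)] pos
      by (intro add_mono mult_mono) (auto simp: dist_real_def)
    finally show "dist (f t * g t) (f t' * g t') \<le> (\<bar>a\<bar> * C' + C * \<bar>b\<bar>) * dist t t'"
      by (simp add: dist_real_def algebra_simps)
  qed (use pos in simp)
  then show ?thesis unfolding lipschitz_fun_def by blast
qed

text \<open>A product changes either through its coefficient, which is Lipschitz, while the other factor
  is bounded, or through the unknown function, while the coefficient is at most \<open>w\<close>. The factor
  \<open>2\<close> counts the two unknown functions.\<close>

lemma increment_bound:
  fixes f1 f2 a b p :: "real \<Rightarrow> real"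
  assumes a: "lipschitz_fun X a" and b: "lipschitz_fun X b" and p: "lipschitz_fun X p"
    and f1: "\<And>u. u \<in> X \<Longrightarrow> \<bar>f1 u\<bar> \<le> M" and f2: "\<And>u. u \<in> X \<Longrightarrow> \<bar>f2 u\<bar> \<le> M"
    and a_le: "\<And>u. u \<in> X \<Longrightarrow> \<bar>a u\<bar> \<le> w" and b_le: "\<And>u. u \<in> X \<Longrightarrow> \<bar>b u\<bar> \<le> w"
    and F: "\<And>u. u \<in> X \<Longrightarrow> F u = a u * f1 u + b u * f2 u + p u"
  shows "\<exists>K\<ge>0. \<forall>u\<in>X. \<forall>v\<in>X.
    \<bar>F u - F v\<bar> \<le> K * \<bar>u - v\<bar> + 2 * w * max \<bar>f1 u - f1 v\<bar> \<bar>f2 u - f2 v\<bar>"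
proof -
  obtain Ca Cb Cp where C: "Ca-lipschitz_on X a" "Cb-lipschitz_on X b" "Cp-lipschitz_on X p"
    using a b p unfolding lipschitz_fun_def by blast
  have pos: "0 \<le> Ca" "0 \<le> Cb" "0 \<le> Cp" using C lipschitz_on_nonneg by auto
  have "\<bar>F u - F v\<bar> \<le> (Ca * \<bar>M\<bar> + Cb * \<bar>M\<bar> + Cp) * \<bar>u - v\<bar>
      + 2 * w * max \<bar>f1 u - f1 v\<bar> \<bar>f2 u - f2 v\<bar>" if uv: "u \<in> X" "v \<in> X" for u v
  proof -
    define m where "m = max \<bar>f1 u - f1 v\<bar> \<bar>f2 u - f2 v\<bar>"
    have w: "0 \<le> w" using a_le[OF uv(1)] by linarith
    have "\<bar>(a u - a v) * f1 v\<bar> \<le> Ca * \<bar>u - v\<bar> * \<bar>M\<bar>" "\<bar>(b u - b v) * f2 v\<bar> \<le> Cb * \<bar>u - v\<bar> * \<bar>M\<bar>"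
      using lipschitz_onD[OF C(1) uv] lipschitz_onD[OF C(2) uv] f1[OF uv(2)] f2[OF uv(2)] pos
      by (auto simp: abs_mult dist_real_def intro!: mult_mono)
    moreover have "\<bar>p u - p v\<bar> \<le> Cp * \<bar>u - v\<bar>"
      using lipschitz_onD[OF C(3) uv] by (simp add: dist_real_def)
    moreover have "\<bar>a u * (f1 u - f1 v)\<bar> \<le> w * m" "\<bar>b u * (f2 u - f2 v)\<bar> \<le> w * m"
      using a_le[OF uv(1)] b_le[OF uv(1)] w
      by (auto simp: abs_mult m_def intro!: mult_mono)
    moreover have "F u - F v = a u * (f1 u - f1 v) + (a u - a v) * f1 v
        + (b u * (f2 u - f2 v) + (b u - b v) * f2 v) + (p u - p v)"
      using F uv by (simp add: algebra_simps)
    moreover have "\<bar>p1 + p2 + (p3 + p4) + p5\<bar> \<le> \<bar>p1\<bar> + \<bar>p2\<bar> + (\<bar>p3\<bar> + \<bar>p4\<bar>) + \<bar>p5\<bar>"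
      for p1 p2 p3 p4 p5 :: real
      by linarith
    ultimately have "\<bar>F u - F v\<bar> \<le> w * m + Ca * \<bar>u - v\<bar> * \<bar>M\<bar> + (w * m + Cb * \<bar>u - v\<bar> * \<bar>M\<bar>)
        + Cp * \<bar>u - v\<bar>"
      by (smt (verit) add_mono order_trans)
    then show ?thesis unfolding m_def by (simp add: algebra_simps)
  qed
  then show ?thesis
    using pos by (intro exI[of _ "Ca * \<bar>M\<bar> + Cb * \<bar>M\<bar> + Cp"]) auto
qed

section \<open>The interpolation data\<close>

context hvfif_setup
begin

lemma n_pos: "0 < n"
  using x_0 x_n by (cases n) auto

lemma L_onto: "i \<in> {1..n} \<Longrightarrow> L i ` {0..1} = subint x i"
  using L_sim[of i] x_0 x_n unfolding similarity_contraction_def homeomorphism_def by auto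

lemma L_inj: "i \<in> {1..n} \<Longrightarrow> inj_on (L i) {0..1}"
  using L_sim[of i] x_0 x_n unfolding similarity_contraction_def homeomorphism_def
  by (metis inj_on_inverseI)

lemma piece_pos:
  assumes "i \<in> {1..n}" shows "x (i - 1) < x i"
  using x_less[of "i - 1"] assms by (cases i) auto

lemma len_bounds:
  assumes "i \<in> {1..n}"
  shows "len_min n x \<le> x i - x (i - 1)" "x i - x (i - 1) \<le> len_max n x"
  using assms unfolding len_min_def len_max_def by (auto intro!: Min_le Max_ge)

lemma len_min_pos: "0 < len_min n x"
  unfolding len_min_def using n_pos piece_pos by (subst Min_gr_iff) auto

text \<open>The ratio of the similarity is found by applying it to the two endpoints, which are sent to
  two neighbouring knots, in either order.\<close>

lemma L_scale:
  assumes i: "i \<in> {1..n}" and uv: "u \<in> {0..1}" "v \<in> {0..1}"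
  shows "\<bar>L i u - L i v\<bar> = (x i - x (i - 1)) * \<bar>u - v\<bar>"
proof -
  obtain c where c: "\<forall>a\<in>{0..1}. \<forall>b\<in>{0..1}. \<bar>L i a - L i b\<bar> = c * \<bar>a - b\<bar>"
    using L_sim[OF i] x_0 x_n unfolding similarity_contraction_def dist_real_def by auto
  have "{L i 0, L i 1} = {x (i - 1), x i}"
    using L_ends[OF i] x_0 x_n by simp
  then have "\<bar>L i 0 - L i 1\<bar> = x i - x (i - 1)"
    using piece_pos[OF i] by (auto simp: doubleton_eq_iff)
  then have "c = x i - x (i - 1)" using c by simp
  then show ?thesis using c uv by blast
qed

lemma lipschitz_pullback:
  assumes i: "i \<in> {1..n}" and f: "lipschitz_fun (subint x i) f"
  shows "lipschitz_fun {0..1} (\<lambda>u. f (L i u))"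
proof (rule lipschitz_fun_compose[OF f])
  have "(x i - x (i - 1))-lipschitz_on {0..1} (L i)"
    using L_scale[OF i] piece_pos[OF i] by (intro lipschitz_onI) (auto simp: dist_real_def)
  then show "lipschitz_fun {0..1} (L i)" unfolding lipschitz_fun_def by blast
qed (use L_onto[OF i] in simp)

lemma lipschitz_qfun:
  assumes i: "i \<in> {1..n}"
    and "lipschitz_fun (subint x i) (a i)" "lipschitz_fun (subint x i) (b i)"
    and "lipschitz_fun (subint x i) (k i)"
  shows "lipschitz_fun {0..1} (qfun L a b g g' k i)"
proof -
  have "lipschitz_fun {0..1} (\<lambda>u. - (a i (L i u) * g i u) + - (b i (L i u) * g' i u) + k i (L i u))"
    using assms g_lip[OF i] g'_lip[OF i] x_0 x_n
    by (intro lipschitz_fun_add lipschitz_fun_uminus lipschitz_fun_mult lipschitz_pullback) auto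
  then show ?thesis unfolding qfun_def by simp
qed

end

text \<open>The bound by \<open>1\<close> guarantees that the supremum in \<open>omega\<close> is that of a bounded set; the
  supremum of an unbounded set of reals would have an unspecified value.\<close>

lemma abs_le_omega:
  assumes i: "i \<in> {1..n}" and t: "t \<in> subint x i"
    and "\<And>t. t \<in> subint x i \<Longrightarrow> \<bar>a i t\<bar> < 1" "\<And>t. t \<in> subint x i \<Longrightarrow> \<bar>b i t\<bar> < 1"
  shows "\<bar>a i t\<bar> \<le> omega n x a b" "\<bar>b i t\<bar> \<le> omega n x a b"
proof -
  have "max \<bar>a i t\<bar> \<bar>b i t\<bar> \<le> (SUP t\<in>subint x i. max \<bar>a i t\<bar> \<bar>b i t\<bar>)"
    using t assms(3,4) by (intro cSUP_upper bdd_aboveI2[of _ _ 1]) (auto intro: less_imp_le)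
  also have "\<dots> \<le> omega n x a b"
    unfolding omega_def using i by (intro Max_ge) auto
  finally show "\<bar>a i t\<bar> \<le> omega n x a b" "\<bar>b i t\<bar> \<le> omega n x a b" by auto
qed

section \<open>Hoelder continuity of the interpolation function\<close>

theorem theorem3:
  fixes n :: nat
    and x y z :: "nat \<Rightarrow> real"
    and L s s' st st' g g' h ht :: "nat \<Rightarrow> real \<Rightarrow> real"
    and f1 :: "real \<Rightarrow> real"
  assumes "hvfif_setup n x y z L s s' st st' g g' h ht"
    and "is_HVFIF n x y z L s s' st st' g g' h ht f1"
    and "max (omega n x s s') (omega n x st st') < len_min n x / (2 * len_max n x)"
  shows "\<exists>L1 \<tau>1. 0 < L1 \<and> 0 < \<tau>1 \<and> \<tau>1 \<le> 1 \<and>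
           (\<forall>t\<in>{0..1}. \<forall>t'\<in>{0..1}. \<bar>f1 t - f1 t'\<bar> \<le> L1 * \<bar>t - t'\<bar> powr \<tau>1)"
proof -
  interpret hvfif_setup n x y z L s s' st st' g g' h ht by fact
  obtain f2 where pair: "hvfif_pair n x y z L s s' st st' g g' h ht f1 f2"
    using assms(2) unfolding is_HVFIF_def by blast
  define w where "w = max (omega n x s s') (omega n x st st')"
  define D where "D = (\<lambda>a b. max \<bar>f1 a - f1 b\<bar> \<bar>f2 a - f2 b\<bar>)"
  have cont: "continuous_on {0..1} (\<lambda>t. (f1 t, f2 t))"
    using pair x_0 x_n unfolding hvfif_pair_def by simp
  obtain M where M: "\<And>u. u \<in> {0..1} \<Longrightarrow> \<bar>f1 u\<bar> \<le> M" "\<And>u. u \<in> {0..1} \<Longrightarrow> \<bar>f2 u\<bar> \<le> M"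
  proof -
    have "bounded ((\<lambda>t. (f1 t, f2 t)) ` {0..1})"
      using cont by (intro compact_imp_bounded compact_continuous_image) auto
    then obtain M where "\<And>u. u \<in> {0..1} \<Longrightarrow> norm (f1 u, f2 u) \<le> M"
      unfolding bounded_iff ball_simps by blast
    then show ?thesis
      using that norm_fst_le[of "f1 _" "f2 _"] norm_snd_le[of "f2 _" "f1 _"]
      by (metis order_trans real_norm_def)
  qed
  have eqs: "f1 (L i u) = s i (L i u) * f1 u + s' i (L i u) * f2 u + qfun L s s' g g' h i u"
    "f2 (L i u) = st i (L i u) * f1 u + st' i (L i u) * f2 u + qfun L st st' g g' ht i u"
    if "i \<in> {1..n}" "u \<in> {0..1}" for i u
  proof -
    have "the_inv_into {x 0..x n} (L i) (L i u) = u"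
      using the_inv_into_f_f[OF L_inj[OF that(1)] that(2)] x_0 x_n by simp
    moreover have "L i u \<in> subint x i" using L_onto[OF that(1)] that(2) by blast
    ultimately show "f1 (L i u) = s i (L i u) * f1 u + s' i (L i u) * f2 u + qfun L s s' g g' h i u"
      "f2 (L i u) = st i (L i u) * f1 u + st' i (L i u) * f2 u + qfun L st st' g g' ht i u"
      using pair that(1) unfolding hvfif_pair_def Let_def by auto
  qed
  have w_bounds: "\<bar>s i (L i u)\<bar> \<le> w" "\<bar>s' i (L i u)\<bar> \<le> w" "\<bar>st i (L i u)\<bar> \<le> w" "\<bar>st' i (L i u)\<bar> \<le> w"
    if "i \<in> {1..n}" "u \<in> {0..1}" for i u
  proof -
    have t: "L i u \<in> subint x i" using L_onto[OF that(1)] that(2) by blast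
    show "\<bar>s i (L i u)\<bar> \<le> w" "\<bar>s' i (L i u)\<bar> \<le> w" "\<bar>st i (L i u)\<bar> \<le> w" "\<bar>st' i (L i u)\<bar> \<le> w"
      using abs_le_omega[of i n "L i u" x s s'] abs_le_omega[of i n "L i u" x st st']
        s_less s'_less st_less st'_less that(1) t
      unfolding w_def by (auto simp: le_max_iff_disj)
  qed
  have "\<exists>K\<ge>0. \<forall>u\<in>{0..1}. \<forall>v\<in>{0..1}. D (L i u) (L i v) \<le> K * \<bar>u - v\<bar> + 2 * w * D u v"
    if i: "i \<in> {1..n}" for i
  proof -
    have "\<exists>K\<ge>0. \<forall>u\<in>{0..1}. \<forall>v\<in>{0..1}.
        \<bar>f1 (L i u) - f1 (L i v)\<bar> \<le> K * \<bar>u - v\<bar> + 2 * w * D u v"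
      unfolding D_def
      by (rule increment_bound[OF lipschitz_pullback[OF i s_lip[OF i]]
            lipschitz_pullback[OF i s'_lip[OF i]]
            lipschitz_qfun[of i s s' h, OF i s_lip[OF i] s'_lip[OF i] h_lip[OF i]]
            M w_bounds(1,2)[OF i] eqs(1)[OF i]])
    then obtain K1 where K1: "0 \<le> K1" "\<forall>u\<in>{0..1}. \<forall>v\<in>{0..1}.
        \<bar>f1 (L i u) - f1 (L i v)\<bar> \<le> K1 * \<bar>u - v\<bar> + 2 * w * D u v"
      by blast
    have "\<exists>K\<ge>0. \<forall>u\<in>{0..1}. \<forall>v\<in>{0..1}.
        \<bar>f2 (L i u) - f2 (L i v)\<bar> \<le> K * \<bar>u - v\<bar> + 2 * w * D u v"
      unfolding D_def
      by (rule increment_bound[OF lipschitz_pullback[OF i st_lip[OF i]]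
            lipschitz_pullback[OF i st'_lip[OF i]]
            lipschitz_qfun[of i st st' ht, OF i st_lip[OF i] st'_lip[OF i] ht_lip[OF i]]
            M w_bounds(3,4)[OF i] eqs(2)[OF i]])
    then obtain K2 where K2: "0 \<le> K2" "\<forall>u\<in>{0..1}. \<forall>v\<in>{0..1}.
        \<bar>f2 (L i u) - f2 (L i v)\<bar> \<le> K2 * \<bar>u - v\<bar> + 2 * w * D u v"
      by blast
    have "D (L i u) (L i v) \<le> max K1 K2 * \<bar>u - v\<bar> + 2 * w * D u v"
      if uv: "u \<in> {0..1}" "v \<in> {0..1}" for u v
    proof -
      have "K1 * \<bar>u - v\<bar> \<le> max K1 K2 * \<bar>u - v\<bar>" "K2 * \<bar>u - v\<bar> \<le> max K1 K2 * \<bar>u - v\<bar>"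
        by (auto intro: mult_right_mono)
      moreover have "\<bar>f1 (L i u) - f1 (L i v)\<bar> \<le> K1 * \<bar>u - v\<bar> + 2 * w * D u v"
        "\<bar>f2 (L i u) - f2 (L i v)\<bar> \<le> K2 * \<bar>u - v\<bar> + 2 * w * D u v"
        using K1(2) K2(2) uv by blast+
      ultimately show ?thesis unfolding D_def by simp
    qed
    then show ?thesis using K1(1) by (intro exI[of _ "max K1 K2"]) auto
  qed
  then obtain K where K: "\<And>i. i \<in> {1..n} \<Longrightarrow> 0 \<le> K i"
    "\<And>i u v. i \<in> {1..n} \<Longrightarrow> u \<in> {0..1} \<Longrightarrow> v \<in> {0..1} \<Longrightarrow>
       D (L i u) (L i v) \<le> K i * \<bar>u - v\<bar> + 2 * w * D u v"
    by metis
  \<comment> \<open>A single Lipschitz constant that serves for all subintervals.\<close>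
  have K_sum: "K i \<le> sum K {1..n}" if "i \<in> {1..n}" for i
    using that K(1) by (intro member_le_sum) auto
  have w_nonneg: "0 \<le> w"
    using w_bounds(1)[of 1 0] n_pos by fastforce
  have w_less: "2 * w < 1"
  proof -
    have "len_min n x \<le> len_max n x" using len_bounds[of 1] n_pos by simp
    then have "len_min n x / (2 * len_max n x) \<le> 1 / 2"
      using len_min_pos by (simp add: divide_simps)
    then show ?thesis using assms(3) unfolding w_def by linarith
  qed
  interpret selfsimilar_increments n x L D "len_min n x" "sum K {1..n}" "2 * w" "2 * M"
  proof
    show "D a b \<le> 2 * M" if "a \<in> {0..1}" "b \<in> {0..1}" for a b
      using M(1)[OF that(1)] M(1)[OF that(2)] M(2)[OF that(1)] M(2)[OF that(2)]
      unfolding D_def by linarith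
    show "D (L i u) (L i v) \<le> sum K {1..n} * \<bar>u - v\<bar> + 2 * w * D u v"
      if "i \<in> {1..n}" "u \<in> {0..1}" "v \<in> {0..1}" for i u v
      using K(2)[OF that] mult_right_mono[OF K_sum[OF that(1)], of "\<bar>u - v\<bar>"] by simp
    show "0 \<le> 2 * M" using M(1)[of 0] by fastforce
    show "0 \<le> sum K {1..n}" by (rule sum_nonneg) (rule K(1))
    show "L i ` {0..1} = {x (i - 1)..x i}" if "i \<in> {1..n}" for i
      using L_onto[OF that] unfolding subint_def .
    show "L i ` {0, 1} = {x (i - 1), x i}" if "i \<in> {1..n}" for i
      using L_ends[OF that] x_0 x_n by simp
    show "D a b = D b a" for a b
      unfolding D_def by (simp add: abs_minus_commute)
    show "D a c \<le> D a b + D b c" for a b c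
      unfolding D_def by linarith
  qed (use x_0 x_n len_min_pos len_bounds(1) L_scale w_nonneg w_less in auto)
  obtain B \<tau> where "0 < B" "0 < \<tau>" "\<tau> \<le> 1"
    "\<And>a b. a \<in> {0..1} \<Longrightarrow> b \<in> {0..1} \<Longrightarrow> D a b \<le> B * \<bar>a - b\<bar> powr \<tau>"
    using holder by blast
  then show ?thesis
    unfolding D_def by (intro exI[of _ B] exI[of _ \<tau>]) auto
qed

end
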